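(* Let $q\ge 1$ be an integer and let $T$ be an infinite $(q+1)$-homogeneous tree rooted at $o$. For $1\le p\le\infty$, let $X$ equal either $\mathbb{T}_p$ or $\mathbb{T}_{p,0}$ or $C_c(T)$, with norm $\|\cdot\|_p$, and let $M_\psi$ be a bounded multiplication operator on $X$, where $\psi\colon T\to\mathbb{C}$. Then (a) $\sigma_e(M_\psi)=\psi(T)$, the range of $\psi$; (b) $\sigma(M_\psi)=\sigma_a(M_\psi)=\overline{\psi(T)}$, the closure of $\psi(T)$ in $\mathbb{C}$.
   Context: A $(q+1)$-homogeneous tree is a connected graph without cycles in which every vertex has exactly $q+1$ neighbours; rooted means that a vertex $o$ (the root) is singled out. For a vertex $v$, $|v|$ is the number of edges in the unique path from $o$ to $v$; for $n\ge1$ there are $(q+1)q^{n-1}$ vertices with $|v|=n$. Functions on $T$ are functions on its vertices. $\mathbb{N}=\{1,2,\dots\}$, $\mathbb{N}_0=\mathbb{N}\cup\{0\}$. For $f\colon T\to\mathbb{C}$ and $n\in\mathbb{N}$, $M_p(n,f)=\left(\frac{1}{(q+1)q^{n-1}}\sum_{|v|=n}|f(v)|^p\right)^{1/p}$ if $0<p<\infty$, $M_\infty(n,f)=\max_{|v|=n}|f(v)|$, and $M_p(0,f)=|f(o)|$ for all $p\in(0,\infty]$. Put $\|f\|_p=\sup_{n\in\mathbb{N}_0}M_p(n,f)$, $\mathbb{T}_p=\{f\colon T\to\mathbb{C}:\|f\|_p<\infty\}$ and $\mathbb{T}_{p,0}=\{f\in\mathbb{T}_p:\lim_{n\to\infty}M_p(n,f)=0\}$.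 $C_c(T)$ is the set of all $f\colon T\to\mathbb{C}$ such that $M_p(n,f)=0$ for all but finitely many $n$ (equivalently, finitely supported functions). The multiplication operator with symbol $\psi$ is $M_\psi f=\psi f$ (pointwise product), here assumed to map $X$ to $X$ boundedly. For a bounded linear operator $A$ on a complex normed space $X$: the point spectrum $\sigma_e(A)$ is the set of $\lambda\in\mathbb{C}$ such that $A-\lambda I$ is not injective; the approximate point spectrum $\sigma_a(A)$ is the set of $\lambda\in\mathbb{C}$ such that $A-\lambda I$ is not bounded below, i.e. there are $x_n\in X$ with $\|x_n\|=1$ and $\|Ax_n-\lambda x_n\|\to0$; the spectrum $\sigma(A)$ is the set of $\lambda\in\mathbb{C}$ such that $A-\lambda I$ is not invertible, where invertible means having an inverse that is a bounded linear operator on $X$. *)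

theory Defs
  imports "HOL-Analysis.Analysis"
begin

text \<open>
  The vertices are the elements of a type \<open>'v\<close>, the edges are given by an adjacency relation.
  The trees of the theory Graph_Theory.Digraph_Component are directed graphs without
  directed cycles, which is not the notion needed here: in a bidirected graph every edge already
  is a cycle of length two.
\<close>

definition simple_graph :: "('v \<Rightarrow> 'v \<Rightarrow> bool) \<Rightarrow> bool" where
  "simple_graph adj \<longleftrightarrow> symp adj \<and> irreflp adj"

definition path_between :: "('v \<Rightarrow> 'v \<Rightarrow> bool) \<Rightarrow> 'v \<Rightarrow> 'v \<Rightarrow> 'v list \<Rightarrow> bool" where
  "path_between adj u v xs \<longleftrightarrow>
     xs \<noteq> [] \<and> hd xs = u \<and> last xs = v \<and> distinct xs \<and> successively adj xs"

definition graph_connected :: "('v \<Rightarrow> 'v \<Rightarrow> bool) \<Rightarrow> bool" where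
  "graph_connected adj \<longleftrightarrow> (\<forall>u v. \<exists>xs. path_between adj u v xs)"

definition graph_cycle :: "('v \<Rightarrow> 'v \<Rightarrow> bool) \<Rightarrow> 'v list \<Rightarrow> bool" where
  "graph_cycle adj xs \<longleftrightarrow>
     length xs \<ge> 3 \<and> distinct xs \<and> successively adj xs \<and> adj (last xs) (hd xs)"

definition homogeneous_tree :: "nat \<Rightarrow> ('v \<Rightarrow> 'v \<Rightarrow> bool) \<Rightarrow> bool" where
  "homogeneous_tree d adj \<longleftrightarrow>
     simple_graph adj \<and> graph_connected adj \<and> (\<nexists>xs. graph_cycle adj xs) \<and>
     (\<forall>v. finite {w. adj v w} \<and> card {w. adj v w} = d)"

text \<open>
  Number of edges of the unique path from the root \<open>r\<close> to \<open>v\<close>; paths are lists of vertices, so this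
  is the length of the list minus one.
\<close>

definition tree_level :: "('v \<Rightarrow> 'v \<Rightarrow> bool) \<Rightarrow> 'v \<Rightarrow> 'v \<Rightarrow> nat" where
  "tree_level adj r v = length (THE xs. path_between adj r v xs) - 1"

definition tree_sphere :: "('v \<Rightarrow> 'v \<Rightarrow> bool) \<Rightarrow> 'v \<Rightarrow> nat \<Rightarrow> 'v set" where
  "tree_sphere adj r n = {v. tree_level adj r v = n}"

definition tree_mean ::
  "('v \<Rightarrow> 'v \<Rightarrow> bool) \<Rightarrow> 'v \<Rightarrow> nat \<Rightarrow> ereal \<Rightarrow> nat \<Rightarrow> ('v \<Rightarrow> complex) \<Rightarrow> real" where
  "tree_mean adj r q p n f =
     (if n = 0 then cmod (f r)
      else if p = \<infinity> then Max ((\<lambda>v. cmod (f v)) ` tree_sphere adj r n)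
      else (1 / ((real q + 1) * real q ^ (n - 1)) *
             (\<Sum>v\<in>tree_sphere adj r n. cmod (f v) powr real_of_ereal p))
           powr (1 / real_of_ereal p))"

definition hardy_enorm ::
  "('v \<Rightarrow> 'v \<Rightarrow> bool) \<Rightarrow> 'v \<Rightarrow> nat \<Rightarrow> ereal \<Rightarrow> ('v \<Rightarrow> complex) \<Rightarrow> ereal" where
  "hardy_enorm adj r q p f = (SUP n. ereal (tree_mean adj r q p n f))"

text \<open>The real-valued norm, meaningful on functions whose extended norm is finite.\<close>

definition hardy_norm ::
  "('v \<Rightarrow> 'v \<Rightarrow> bool) \<Rightarrow> 'v \<Rightarrow> nat \<Rightarrow> ereal \<Rightarrow> ('v \<Rightarrow> complex) \<Rightarrow> real" where
  "hardy_norm adj r q p f = real_of_ereal (hardy_enorm adj r q p f)"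

definition hardy_space ::
  "('v \<Rightarrow> 'v \<Rightarrow> bool) \<Rightarrow> 'v \<Rightarrow> nat \<Rightarrow> ereal \<Rightarrow> ('v \<Rightarrow> complex) set" where
  "hardy_space adj r q p = {f. hardy_enorm adj r q p f < \<infinity>}"

definition little_hardy_space ::
  "('v \<Rightarrow> 'v \<Rightarrow> bool) \<Rightarrow> 'v \<Rightarrow> nat \<Rightarrow> ereal \<Rightarrow> ('v \<Rightarrow> complex) set" where
  "little_hardy_space adj r q p =
     {f \<in> hardy_space adj r q p. (\<lambda>n. tree_mean adj r q p n f) \<longlonglongrightarrow> 0}"

text \<open>
  For every \<open>p > 0\<close> this is the set of finitely supported functions.
\<close>

definition cc_space ::
  "('v \<Rightarrow> 'v \<Rightarrow> bool) \<Rightarrow> 'v \<Rightarrow> nat \<Rightarrow> ereal \<Rightarrow> ('v \<Rightarrow> complex) set" where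
  "cc_space adj r q p = {f. finite {n. tree_mean adj r q p n f \<noteq> 0}}"

definition mult_op :: "('v \<Rightarrow> complex) \<Rightarrow> ('v \<Rightarrow> complex) \<Rightarrow> 'v \<Rightarrow> complex" where
  "mult_op \<psi> f = (\<lambda>v. \<psi> v * f v)"

text \<open>
  A normed space is given by a linear subspace \<open>X\<close> of the complex functions on \<open>'v\<close> and a norm
  \<open>N\<close> on it. Operators are total functions in the logic, but only their values on \<open>X\<close> matter.
\<close>

definition bounded_operator_on ::
  "('v \<Rightarrow> complex) set \<Rightarrow> (('v \<Rightarrow> complex) \<Rightarrow> real) \<Rightarrow>
   (('v \<Rightarrow> complex) \<Rightarrow> 'v \<Rightarrow> complex) \<Rightarrow> bool" where
  "bounded_operator_on X N A \<longleftrightarrow>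
     (\<forall>f\<in>X. A f \<in> X) \<and>
     (\<forall>f\<in>X. \<forall>g\<in>X. A (\<lambda>v. f v + g v) = (\<lambda>v. A f v + A g v)) \<and>
     (\<forall>c. \<forall>f\<in>X. A (\<lambda>v. c * f v) = (\<lambda>v. c * A f v)) \<and>
     (\<exists>C. \<forall>f\<in>X. N (A f) \<le> C * N f)"

definition op_shift ::
  "(('v \<Rightarrow> complex) \<Rightarrow> 'v \<Rightarrow> complex) \<Rightarrow> complex \<Rightarrow> ('v \<Rightarrow> complex) \<Rightarrow> 'v \<Rightarrow> complex" where
  "op_shift A \<mu> f = (\<lambda>v. A f v - \<mu> * f v)"

definition invertible_on ::
  "('v \<Rightarrow> complex) set \<Rightarrow> (('v \<Rightarrow> complex) \<Rightarrow> real) \<Rightarrow>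
   (('v \<Rightarrow> complex) \<Rightarrow> 'v \<Rightarrow> complex) \<Rightarrow> bool" where
  "invertible_on X N A \<longleftrightarrow>
     (\<exists>B. bounded_operator_on X N B \<and> (\<forall>f\<in>X. B (A f) = f \<and> A (B f) = f))"

definition point_spectrum ::
  "('v \<Rightarrow> complex) set \<Rightarrow> (('v \<Rightarrow> complex) \<Rightarrow> 'v \<Rightarrow> complex) \<Rightarrow> complex set" where
  "point_spectrum X A = {\<mu>. \<not> inj_on (op_shift A \<mu>) X}"

definition approx_point_spectrum ::
  "('v \<Rightarrow> complex) set \<Rightarrow> (('v \<Rightarrow> complex) \<Rightarrow> real) \<Rightarrow>
   (('v \<Rightarrow> complex) \<Rightarrow> 'v \<Rightarrow> complex) \<Rightarrow> complex set" where
  "approx_point_spectrum X N A =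
     {\<mu>. \<exists>x :: nat \<Rightarrow> 'v \<Rightarrow> complex.
          (\<forall>n. x n \<in> X \<and> N (x n) = 1) \<and> (\<lambda>n. N (op_shift A \<mu> (x n))) \<longlonglongrightarrow> 0}"

definition spectrum_on ::
  "('v \<Rightarrow> complex) set \<Rightarrow> (('v \<Rightarrow> complex) \<Rightarrow> real) \<Rightarrow>
   (('v \<Rightarrow> complex) \<Rightarrow> 'v \<Rightarrow> complex) \<Rightarrow> complex set" where
  "spectrum_on X N A = {\<mu>. \<not> invertible_on X N (op_shift A \<mu>)}"

end

theory Submission
  imports Defs
begin

text \<open>
  All three spaces are solid: if \<open>\<bar>f\<bar> \<le> C \<bar>g\<bar>\<close> pointwise and \<open>g \<in> X\<close>, then \<open>f \<in> X\<close> and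
  \<open>\<parallel>f\<parallel> \<le> C \<parallel>g\<parallel>\<close>. They also contain the indicator functions of single vertices, with nonzero norm.
  Nothing else is needed. The indicator of \<open>v\<close> is an eigenvector for \<open>\<psi> v\<close>, and these
  eigenvectors, normalised, put the closure of the range into the approximate point spectrum. If
  \<open>\<mu>\<close> is at distance \<open>e > 0\<close> from the range, then division by \<open>\<psi> - \<mu>\<close> is an inverse that is
  bounded by \<open>1 / e\<close>.
\<close>

section \<open>Spectra of multiplication operators on solid function spaces\<close>

definition vertex_indicator :: "'v \<Rightarrow> 'v \<Rightarrow> complex" where
  "vertex_indicator v w = (if w = v then 1 else 0)"

locale solid_function_space =
  fixes X :: "('v \<Rightarrow> complex) set" and N :: "('v \<Rightarrow> complex) \<Rightarrow> real"
  assumes solid: "g \<in> X \<Longrightarrow> 0 \<le> C \<Longrightarrow> (\<And>v. cmod (f v) \<le> C * cmod (g v)) \<Longrightarrow> f \<in> X \<and> N f \<le> C * N g"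
    and norm_nonneg: "f \<in> X \<Longrightarrow> 0 \<le> N f"
    and indicator_mem: "vertex_indicator v \<in> X"
    and norm_indicator_pos: "0 < N (vertex_indicator v)"
begin

section \<open>Homogeneity of the norm and bounds on the symbol\<close>

text \<open>Solidity gives only inequalities; equality comes from using it twice, once with the
  factor \<open>c\<close> and once with \<open>1 / c\<close> on the scaled function.\<close>

lemma norm_scale:
  assumes "f \<in> X"
  shows "(\<lambda>v. c * f v) \<in> X" "N (\<lambda>v. c * f v) = cmod c * N f"
proof -
  have *: "(\<lambda>v. c * f v) \<in> X \<and> N (\<lambda>v. c * f v) \<le> cmod c * N f" if "f \<in> X" for c f
    by (rule solid[OF that]) (auto simp: norm_mult)
  show mem: "(\<lambda>v. c * f v) \<in> X"
    using * assms by blast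
  show "N (\<lambda>v. c * f v) = cmod c * N f"
  proof (cases "c = 0")
    case True
    then show ?thesis
      using *[OF assms, of c] norm_nonneg[OF mem] by simp
  next
    case False
    have "N f \<le> N (\<lambda>v. c * f v) / cmod c"
      using *[OF mem, of "1 / c"] False by (simp add: norm_divide)
    with *[OF assms, of c] False show ?thesis
      by (simp add: field_simps)
  qed
qed

text \<open>The free scalar \<open>c\<close> lets one equation serve both the normalised indicators
  (\<open>c\<close> the reciprocal of the norm) and the zero function
  (\<open>c = 0\<close>).\<close>

lemma op_shift_indicator:
  "op_shift (mult_op \<psi>) \<mu> (\<lambda>w. c * vertex_indicator v w) = (\<lambda>w. (\<psi> v - \<mu>) * (c * vertex_indicator v w))"
  by (auto simp: op_shift_def mult_op_def vertex_indicator_def algebra_simps)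

text \<open>Each indicator is an eigenvector with eigenvalue \<open>\<psi> v\<close> and nonzero
  norm, so every operator bound also bounds \<open>\<psi>\<close>.\<close>

lemma symbol_bounded:
  assumes "bounded_operator_on X N (mult_op \<psi>)"
  obtains C where "\<And>v. cmod (\<psi> v) \<le> C"
proof -
  obtain C where C: "\<And>f. f \<in> X \<Longrightarrow> N (mult_op \<psi> f) \<le> C * N f"
    using assms unfolding bounded_operator_on_def by blast
  have "cmod (\<psi> v) \<le> C" for v
  proof -
    have "mult_op \<psi> (vertex_indicator v) = (\<lambda>w. \<psi> v * vertex_indicator v w)"
      by (auto simp: mult_op_def vertex_indicator_def)
    then have "cmod (\<psi> v) * N (vertex_indicator v) \<le> C * N (vertex_indicator v)"
      using C[OF indicator_mem] norm_scale(2)[OF indicator_mem] by metis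
    then show ?thesis
      using norm_indicator_pos by simp
  qed
  with that show thesis
    by blast
qed

text \<open>The bound on an inverse is available only for arguments in \<open>X\<close>, hence this
  membership. The locale does not provide closure under subtraction; solidity applied to the bounded
  multiplier \<open>\<psi> v - \<mu>\<close> does the job.\<close>

lemma op_shift_mem:
  assumes "bounded_operator_on X N (mult_op \<psi>)" "f \<in> X"
  shows "op_shift (mult_op \<psi>) \<mu> f \<in> X"
proof -
  obtain C where C: "\<And>v. cmod (\<psi> v) \<le> C"
    using symbol_bounded[OF assms(1)] by blast
  have bound: "cmod (\<psi> v - \<mu>) \<le> C + cmod \<mu>" for v
    using C norm_triangle_ineq4 by (metis add_right_mono order_trans)
  have "0 \<le> C"
    using C norm_ge_zero order_trans by blast
  then have "0 \<le> C + cmod \<mu>"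
    by simp
  moreover have "cmod (op_shift (mult_op \<psi>) \<mu> f v) \<le> (C + cmod \<mu>) * cmod (f v)" for v
  proof -
    have "op_shift (mult_op \<psi>) \<mu> f v = (\<psi> v - \<mu>) * f v"
      by (simp add: op_shift_def mult_op_def algebra_simps)
    then show ?thesis
      using bound by (simp add: norm_mult mult_right_mono)
  qed
  ultimately show ?thesis
    using solid[OF assms(2)] by blast
qed

section \<open>The point spectrum and the cycle of inclusions\<close>

lemma point_spectrum_mult_op: "point_spectrum X (mult_op \<psi>) = range \<psi>"
proof (intro equalityI subsetI)
  fix \<mu> assume "\<mu> \<in> point_spectrum X (mult_op \<psi>)"
  then obtain f g where "f \<noteq> g" and eq: "op_shift (mult_op \<psi>) \<mu> f = op_shift (mult_op \<psi>) \<mu> g"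
    unfolding point_spectrum_def inj_on_def by blast
  then obtain v where v: "f v \<noteq> g v"
    by blast
  have "(\<psi> v - \<mu>) * (f v - g v) = 0"
    using fun_cong[OF eq, of v] by (simp add: op_shift_def mult_op_def algebra_simps)
  with v show "\<mu> \<in> range \<psi>"
    by auto
next
  fix \<mu> assume "\<mu> \<in> range \<psi>"
  then obtain v where v: "\<mu> = \<psi> v"
    by blast
  \<comment> \<open>Injectivity fails on the indicator and the zero function; both are written as
    multiples of the indicator so that \<open>op_shift_indicator\<close> and
    \<open>norm_scale\<close> apply to them alike.\<close>
  have "op_shift (mult_op \<psi>) \<mu> (\<lambda>w. 1 * vertex_indicator v w)
      = op_shift (mult_op \<psi>) \<mu> (\<lambda>w. 0 * vertex_indicator v w)"
    unfolding op_shift_indicator v by simp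
  moreover have "(\<lambda>w. 1 * vertex_indicator v w) \<noteq> (\<lambda>w. 0 * vertex_indicator v w)"
    by (auto simp: vertex_indicator_def fun_eq_iff)
  ultimately show "\<mu> \<in> point_spectrum X (mult_op \<psi>)"
    unfolding point_spectrum_def inj_on_def using norm_scale(1)[OF indicator_mem] by blast
qed

lemma closure_range_subset_approx_point_spectrum:
  "closure (range \<psi>) \<subseteq> approx_point_spectrum X N (mult_op \<psi>)"
proof
  fix \<mu> assume "\<mu> \<in> closure (range \<psi>)"
  then obtain y where y: "\<And>n. y n \<in> range \<psi>" "y \<longlonglongrightarrow> \<mu>"
    unfolding closure_sequential by blast
  then have "\<forall>n. \<exists>v. y n = \<psi> v"
    by blast
  then obtain v where v: "\<And>n. y n = \<psi> (v n)"
    by metis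
  define x where
    "x n = (\<lambda>w. complex_of_real (1 / N (vertex_indicator (v n))) * vertex_indicator (v n) w)" for n
  have x: "x n \<in> X" "N (x n) = 1" for n
    using norm_scale[OF indicator_mem, of "complex_of_real (1 / N (vertex_indicator (v n)))" "v n"]
      norm_indicator_pos[of "v n"] unfolding x_def by (auto simp only: norm_of_real) simp
  \<comment> \<open>The approximants \<open>y n\<close> are values of \<open>\<psi>\<close>, so
    \<open>x n\<close> is an exact eigenvector for \<open>y n\<close> and misses being one for
    \<open>\<mu>\<close> only by the factor \<open>y n - \<mu>\<close>.\<close>
  have "op_shift (mult_op \<psi>) \<mu> (x n) = (\<lambda>w. (y n - \<mu>) * x n w)" for n
    unfolding x_def op_shift_indicator v ..
  then have "N (op_shift (mult_op \<psi>) \<mu> (x n)) = cmod (y n - \<mu>)" for n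
    using norm_scale(2)[OF x(1)] x(2) by simp
  moreover have "(\<lambda>n. cmod (y n - \<mu>)) \<longlonglongrightarrow> 0"
    using y(2) LIM_zero tendsto_norm_zero by blast
  ultimately show "\<mu> \<in> approx_point_spectrum X N (mult_op \<psi>)"
    unfolding approx_point_spectrum_def using x by (auto intro!: exI[of _ x])
qed

text \<open>A bounded inverse would recover the unit vectors \<open>x n\<close> from images tending
  to 0, which contradicts its bound in the limit.\<close>

lemma approx_point_spectrum_subset_spectrum:
  assumes "bounded_operator_on X N (mult_op \<psi>)"
  shows "approx_point_spectrum X N (mult_op \<psi>) \<subseteq> spectrum_on X N (mult_op \<psi>)"
proof
  fix \<mu> assume "\<mu> \<in> approx_point_spectrum X N (mult_op \<psi>)"
  then obtain x where x: "\<And>n. x n \<in> X" "\<And>n. N (x n) = 1"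
    and lim: "(\<lambda>n. N (op_shift (mult_op \<psi>) \<mu> (x n))) \<longlonglongrightarrow> 0"
    unfolding approx_point_spectrum_def by blast
  have False if inv: "invertible_on X N (op_shift (mult_op \<psi>) \<mu>)"
  proof -
    obtain B where bdd: "bounded_operator_on X N B"
      and B: "\<forall>f\<in>X. B (op_shift (mult_op \<psi>) \<mu> f) = f \<and> op_shift (mult_op \<psi>) \<mu> (B f) = f"
      using inv unfolding invertible_on_def by blast
    obtain C where C: "\<And>f. f \<in> X \<Longrightarrow> N (B f) \<le> C * N f"
      using bdd unfolding bounded_operator_on_def by blast
    have "1 \<le> C * N (op_shift (mult_op \<psi>) \<mu> (x n))" for n
      using C[OF op_shift_mem[OF assms x(1)]] B x by metis
    moreover have "(\<lambda>n. C * N (op_shift (mult_op \<psi>) \<mu> (x n))) \<longlonglongrightarrow> C * 0"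
      by (intro tendsto_intros lim)
    ultimately have "1 \<le> C * 0"
      by (intro LIMSEQ_le_const) auto
    then show False
      by simp
  qed
  then show "\<mu> \<in> spectrum_on X N (mult_op \<psi>)"
    unfolding spectrum_on_def by blast
qed

lemma spectrum_subset_closure_range: "spectrum_on X N (mult_op \<psi>) \<subseteq> closure (range \<psi>)"
proof (rule ccontr)
  assume "\<not> spectrum_on X N (mult_op \<psi>) \<subseteq> closure (range \<psi>)"
  then obtain \<mu> where \<mu>: "\<mu> \<in> spectrum_on X N (mult_op \<psi>)" "\<mu> \<notin> closure (range \<psi>)"
    by blast
  \<comment> \<open>Lying outside the closure gives one distance \<open>e\<close> that is valid for
    all vertices; this uniformity makes the inverse bounded.\<close>
  then obtain e where e: "e > 0" "\<And>v. e \<le> cmod (\<psi> v - \<mu>)"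
    unfolding closure_approachable dist_norm by (auto simp: not_less)
  have nz: "\<psi> v - \<mu> \<noteq> 0" for v
    using e(1) e(2)[of v] by auto
  define B where "B f = (\<lambda>v. f v / (\<psi> v - \<mu>))" for f
  have "cmod (B f v) \<le> 1 / e * cmod (f v)" for f v
    using e(1) e(2)[of v] frac_le[of "cmod (f v)" "cmod (f v)" e "cmod (\<psi> v - \<mu>)"]
    by (simp add: B_def norm_divide)
  then have "B f \<in> X \<and> N (B f) \<le> 1 / e * N f" if "f \<in> X" for f
    using solid[OF that, of "1 / e" "B f"] e(1) by simp
  then have "\<forall>f\<in>X. B f \<in> X" "\<exists>C. \<forall>f\<in>X. N (B f) \<le> C * N f"
    by blast+
  then have "bounded_operator_on X N B"
    unfolding bounded_operator_on_def by (auto simp: B_def add_divide_distrib)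
  moreover have "B (op_shift (mult_op \<psi>) \<mu> f) = f" "op_shift (mult_op \<psi>) \<mu> (B f) = f" for f
    using nz by (auto simp: B_def op_shift_def mult_op_def fun_eq_iff
        simp flip: left_diff_distrib diff_divide_distrib)
  ultimately show False
    using \<mu>(1) unfolding spectrum_on_def invertible_on_def by blast
qed

end

section \<open>Spheres of a homogeneous tree\<close>

text \<open>If two paths leave \<open>u\<close> through different neighbours, following the first
  until it meets the second and returning along the second closes a cycle. So the second vertices
  agree, and induction applies to the tails.\<close>

lemma acyclic_path_unique:
  assumes "symp adj" "\<nexists>xs. graph_cycle adj xs" "path_between adj u v xs" "path_between adj u v ys"
  shows "xs = ys"
  using assms(3,4)
proof (induction xs arbitrary: u ys)
  case Nil
  then show ?case
    by (simp add: path_between_def)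
next
  case (Cons a xs)
  have [simp]: "a = u"
    using Cons.prems by (simp add: path_between_def)
  obtain zs where ys: "ys = u # zs"
    using Cons.prems(2) by (cases ys) (auto simp: path_between_def)
  have xs_props: "u \<notin> set xs" "distinct xs" "successively adj (u # xs)" "last (u # xs) = v"
    using Cons.prems(1) by (auto simp: path_between_def)
  have zs_props: "u \<notin> set zs" "distinct zs" "successively adj (u # zs)" "last (u # zs) = v"
    using Cons.prems(2) ys by (auto simp: path_between_def)
  show ?case
  proof (cases "xs = [] \<or> zs = []")
    case True
    \<comment> \<open>An empty tail means \<open>v = u\<close>; a nonempty other tail would then end
      in \<open>u\<close>, against distinctness.\<close>
    then have "xs = [] \<and> zs = []"
      using xs_props(1,4) zs_props(1,4) last_in_set[of xs] last_in_set[of zs]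
      by (auto split: if_splits)
    with ys show ?thesis
      by simp
  next
    case False
    then have ne: "xs \<noteq> []" "zs \<noteq> []"
      by auto
    have "hd xs = hd zs"
    proof (rule ccontr)
      assume hd: "hd xs \<noteq> hd zs"
      have "v \<in> set xs" "v \<in> set zs"
        using ne xs_props(4) zs_props(4) by (metis last_ConsR last_in_set)+
      \<comment> \<open>Taking the first vertex \<open>z\<close> of \<open>xs\<close> that lies on
        \<open>zs\<close> makes \<open>xs1\<close> disjoint from \<open>zs\<close>, so the closed
        walk \<open>?c\<close> repeats no vertex.\<close>
      then obtain xs1 z xs2 where xs: "xs = xs1 @ z # xs2" "z \<in> set zs" "\<forall>y\<in>set xs1. y \<notin> set zs"
        using split_list_first_prop[of xs "\<lambda>x. x \<in> set zs"] by blast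
      then obtain zs1 zs2 where zs: "zs = zs1 @ z # zs2"
        by (meson split_list)
      let ?c = "u # xs1 @ z # rev zs1"
      \<comment> \<open>Otherwise both tails would start with \<open>z\<close>. Together with
        \<open>u\<close> and \<open>z\<close> this supplies the third vertex of the cycle.\<close>
      have "xs1 \<noteq> [] \<or> zs1 \<noteq> []"
        using hd xs(1) zs by auto
      then have "length ?c \<ge> 3"
        by (cases xs1; cases zs1) auto
      moreover have "distinct ?c"
        using xs zs xs_props zs_props by auto
      moreover have "successively adj ?c"
      proof -
        have "successively adj ((u # xs1 @ [z]) @ xs2)"
          using xs_props(3) xs(1) by simp
        then have 1: "successively adj (u # xs1 @ [z])"
          by (simp only: successively_append_iff)
        have "successively adj (([u] @ (zs1 @ [z])) @ zs2)"
          using zs_props(3) zs by simp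
        then have "successively adj (zs1 @ [z])"
          by (simp only: successively_append_iff)
        moreover have "(\<lambda>x y. adj y x) = adj"
          by (intro ext) (metis sympD[OF assms(1)])
        ultimately have "successively adj (rev (zs1 @ [z]))"
          by (simp only: successively_rev)
        then have "successively adj (z # rev zs1)"
          by simp
        with 1 show ?thesis
          using successively_append_iff[of adj "u # xs1" "[z]"]
            successively_append_iff[of adj "u # xs1" "z # rev zs1"] by simp
      qed
      moreover have "adj (last ?c) (hd ?c)"
      proof -
        have "adj u (hd zs)"
          using zs_props(3) ne(2) by (simp add: successively_Cons)
        moreover have "last ?c = hd zs"
          using zs by (cases zs1) auto
        ultimately show ?thesis
          using sympD[OF assms(1)] by simp
      qed
      ultimately have "graph_cycle adj ?c"
        unfolding graph_cycle_def by blast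
      with assms(2) show False
        by blast
    qed
    then have "path_between adj (hd xs) v xs" "path_between adj (hd xs) v zs"
      using xs_props zs_props ne by (auto simp: path_between_def successively_Cons)
    then have "xs = zs"
      by (rule Cons.IH)
    with ys show ?thesis
      by simp
  qed
qed

section \<open>Levels, and finiteness and nonemptiness of spheres\<close>

lemma tree_level_path:
  assumes "homogeneous_tree d adj" "path_between adj r v xs"
  shows "tree_level adj r v = length xs - 1"
proof -
  have "(THE xs. path_between adj r v xs) = xs"
  proof (rule the_equality)
    show "path_between adj r v xs"
      by (rule assms(2))
  next
    fix ys assume "path_between adj r v ys"
    then show "ys = xs"
      using acyclic_path_unique[OF _ _ _ assms(2)] assms(1)
      by (simp add: homogeneous_tree_def simple_graph_def)
  qed
  then show ?thesis
    by (simp add: tree_level_def)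
qed

text \<open>Paths are nonempty lists, so the truncated subtraction in \<open>tree_level\<close> can
  be replaced by a successor.\<close>

lemma obtain_path_from_root:
  assumes "homogeneous_tree d adj"
  obtains xs where "path_between adj r v xs" "length xs = Suc (tree_level adj r v)"
proof -
  obtain xs where xs: "path_between adj r v xs"
    using assms unfolding homogeneous_tree_def graph_connected_def by blast
  then have "xs \<noteq> []"
    by (simp add: path_between_def)
  then have "length xs = Suc (tree_level adj r v)"
    using tree_level_path[OF assms xs] by simp
  with xs that show thesis
    by blast
qed

lemma tree_sphere_0:
  assumes "homogeneous_tree d adj"
  shows "tree_sphere adj r 0 = {r}"
proof -
  have "path_between adj r r [r]"
    by (simp add: path_between_def)
  then have "tree_level adj r r = 0"
    using tree_level_path[OF assms] by fastforce
  moreover have "v = r" if "tree_level adj r v = 0" for v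
    using obtain_path_from_root[OF assms, of r v] that
    by (metis length_0_conv length_Suc_conv path_between_def last_ConsL list.sel(1))
  ultimately show ?thesis
    unfolding tree_sphere_def by blast
qed

text \<open>Removing the last vertex of a path from the root leaves a path to a neighbour one level
  lower. Finiteness of spheres and the propagation of emptiness to later spheres both follow from
  this inclusion.\<close>

lemma tree_sphere_Suc_subset:
  assumes "homogeneous_tree d adj"
  shows "tree_sphere adj r (Suc n) \<subseteq> (\<Union>w\<in>tree_sphere adj r n. {v. adj w v})"
proof
  fix v assume "v \<in> tree_sphere adj r (Suc n)"
  then obtain xs where xs: "path_between adj r v xs" "length xs = Suc (Suc n)"
    using obtain_path_from_root[OF assms, of r v] by (auto simp: tree_sphere_def)
  then obtain ys where ys: "xs = ys @ [v]" "length ys = Suc n"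
    by (cases xs rule: rev_cases) (auto simp: path_between_def)
  then have "ys \<noteq> []"
    by auto
  then have "path_between adj r (last ys) ys" "adj (last ys) v"
    using xs(1) ys(1) by (auto simp: path_between_def successively_append_iff)
  with tree_level_path[OF assms] ys(2) show "v \<in> (\<Union>w\<in>tree_sphere adj r n. {v. adj w v})"
    by (force simp: tree_sphere_def)
qed

lemma finite_tree_sphere:
  assumes "homogeneous_tree d adj"
  shows "finite (tree_sphere adj r n)"
proof (induction n)
  case 0
  then show ?case
    using tree_sphere_0[OF assms] by simp
next
  case (Suc n)
  moreover have "finite {v. adj w v}" for w
    using assms by (simp add: homogeneous_tree_def)
  ultimately show ?case
    using finite_subset[OF tree_sphere_Suc_subset[OF assms]] by blast
qed

text \<open>After an empty sphere all later ones are empty, which would leave only finitely many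
  vertices. The result keeps the \<open>Max\<close> in \<open>tree_mean\<close> from being taken
  over the empty set.\<close>

lemma tree_sphere_nonempty:
  assumes "homogeneous_tree d adj" "infinite (UNIV :: 'v set)"
  shows "tree_sphere adj (r :: 'v) n \<noteq> {}"
proof
  assume empty: "tree_sphere adj r n = {}"
  have "tree_sphere adj r (n + k) = {}" for k
    using tree_sphere_Suc_subset[OF assms(1), of r] by (induction k) (auto simp: empty)
  then have "tree_level adj r v < n" for v
    by (metis (mono_tags, lifting) empty_iff le_Suc_ex mem_Collect_eq not_less tree_sphere_def)
  then have "(UNIV :: 'v set) \<subseteq> (\<Union>k<n. tree_sphere adj r k)"
    by (auto simp: tree_sphere_def)
  moreover have "finite (\<Union>k<n. tree_sphere adj r k)"
    using finite_tree_sphere[OF assms(1)] by blast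
  ultimately show False
    using assms(2) finite_subset by blast
qed

section \<open>The three spaces are solid\<close>

lemma tree_mean_mono:
  assumes "finite (tree_sphere adj r n)" "tree_sphere adj r n \<noteq> {}" "0 < p" "0 \<le> C"
    and le: "\<And>v. cmod (f v) \<le> C * cmod (g v)"
  shows "tree_mean adj r q p n f \<le> C * tree_mean adj r q p n g"
proof -
  let ?S = "tree_sphere adj r n"
  consider "n = 0" | "n \<noteq> 0" "p = \<infinity>" | "n \<noteq> 0" "p \<noteq> \<infinity>"
    by blast
  then show ?thesis
  proof cases
    case 1
    then show ?thesis
      using le by (simp add: tree_mean_def)
  next
    case 2
    have "cmod (f v) \<le> C * Max ((\<lambda>v. cmod (g v)) ` ?S)" if "v \<in> ?S" for v
      using le[of v] assms(1,4) that by (meson Max_ge finite_imageI imageI mult_left_mono order_trans)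
    with 2 show ?thesis
      using assms(1,2) by (simp add: tree_mean_def)
  next
    case 3
    define a where "a = real_of_ereal p"
    have a: "a > 0"
      using 3 assms(3) by (cases p) (auto simp: a_def)
    define k where "k = 1 / ((real q + 1) * real q ^ (n - 1))"
    have k: "k \<ge> 0"
      by (simp add: k_def)
    have "(\<Sum>v\<in>?S. cmod (f v) powr a) \<le> (\<Sum>v\<in>?S. (C * cmod (g v)) powr a)"
      using le a by (intro sum_mono powr_mono2) auto
    also have "\<dots> = C powr a * (\<Sum>v\<in>?S. cmod (g v) powr a)"
      using assms(4) by (simp add: powr_mult sum_distrib_left)
    finally have "k * (\<Sum>v\<in>?S. cmod (f v) powr a) \<le> C powr a * (k * (\<Sum>v\<in>?S. cmod (g v) powr a))"
      using k mult_left_mono by (metis mult.left_commute)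
    then have "(k * (\<Sum>v\<in>?S. cmod (f v) powr a)) powr (1 / a)
        \<le> (C powr a * (k * (\<Sum>v\<in>?S. cmod (g v) powr a))) powr (1 / a)"
      using a k by (intro powr_mono2) (auto intro!: mult_nonneg_nonneg sum_nonneg)
    also have "\<dots> = (C powr a) powr (1 / a) * (k * (\<Sum>v\<in>?S. cmod (g v) powr a)) powr (1 / a)"
      by (rule powr_mult)
    \<comment> \<open>This includes \<open>C = 0\<close>, where both sides are 0 because
      \<open>0 powr x = 0\<close>.\<close>
    also have "(C powr a) powr (1 / a) = C"
      using a assms(4) by (simp add: powr_powr)
    finally show ?thesis
      using 3 by (simp add: tree_mean_def a_def k_def)
  qed
qed

lemma tree_mean_nonneg:
  assumes "finite (tree_sphere adj r n)" "tree_sphere adj r n \<noteq> {}"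
  shows "0 \<le> tree_mean adj r q p n f"
  using assms by (auto simp: tree_mean_def Max_ge_iff)

text \<open>The indicator lives on a single sphere. With all other means zero, it belongs to each of
  the three spaces.\<close>

lemma tree_mean_indicator_eq_0:
  assumes "homogeneous_tree d adj" "tree_sphere adj r n \<noteq> {}" "0 < p" "n \<noteq> tree_level adj r v"
  shows "tree_mean adj r q p n (vertex_indicator v) = 0"
proof -
  have zero: "vertex_indicator v w = 0" if "w \<in> tree_sphere adj r n" for w
    using that assms(4) by (auto simp: vertex_indicator_def tree_sphere_def)
  consider "n = 0" | "n \<noteq> 0" "p = \<infinity>" | "n \<noteq> 0" "p \<noteq> \<infinity>"
    by blast
  then show ?thesis
  proof cases
    case 1
    then show ?thesis
      using zero tree_sphere_0[OF assms(1)] by (simp add: tree_mean_def)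
  next
    case 2
    have "(\<lambda>w. cmod (vertex_indicator v w)) ` tree_sphere adj r n = {0}"
      using zero assms(2) by auto
    with 2 show ?thesis
      by (simp add: tree_mean_def)
  next
    case 3
    then show ?thesis
      using zero by (simp add: tree_mean_def)
  qed
qed

lemma tree_mean_indicator_pos:
  assumes "homogeneous_tree d adj" "1 \<le> q"
  shows "0 < tree_mean adj r q p (tree_level adj r v) (vertex_indicator v)"
proof -
  let ?n = "tree_level adj r v"
  have v: "v \<in> tree_sphere adj r ?n"
    by (simp add: tree_sphere_def)
  have fin: "finite (tree_sphere adj r ?n)"
    by (rule finite_tree_sphere[OF assms(1)])
  consider "?n = 0" | "?n \<noteq> 0" "p = \<infinity>" | "?n \<noteq> 0" "p \<noteq> \<infinity>"
    by blast
  then show ?thesis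
  proof cases
    case 1
    then have "v = r"
      using v tree_sphere_0[OF assms(1)] by auto
    with 1 show ?thesis
      by (simp add: tree_mean_def vertex_indicator_def)
  next
    case 2
    have "1 \<le> Max ((\<lambda>w. cmod (vertex_indicator v w)) ` tree_sphere adj r ?n)"
      using fin v by (intro Max_ge) (auto simp: vertex_indicator_def image_iff intro!: bexI[of _ v])
    with 2 show ?thesis
      by (simp add: tree_mean_def)
  next
    case 3
    have "0 < (\<Sum>w\<in>tree_sphere adj r ?n. cmod (vertex_indicator v w) powr real_of_ereal p)"
      by (rule sum_pos2[OF fin v]) (auto simp: vertex_indicator_def)
    \<comment> \<open>Here \<open>1 \<le> q\<close> keeps the normalising denominator
      positive.\<close>
    with 3 show ?thesis
      using assms(2) by (simp add: tree_mean_def)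
  qed
qed

section \<open>The supremum norm and the three spaces\<close>

text \<open>The level-0 term of the supremum is \<open>cmod (f r)\<close>, which already bounds it
  below by 0 and rules out the value minus infinity.\<close>

lemma hardy_enorm_nonneg: "0 \<le> hardy_enorm adj r q p f"
proof -
  have "0 \<le> ereal (tree_mean adj r q p 0 f)"
    by (simp add: tree_mean_def)
  also have "\<dots> \<le> hardy_enorm adj r q p f"
    unfolding hardy_enorm_def by (rule SUP_upper) simp
  finally show ?thesis .
qed

lemma ereal_hardy_norm:
  assumes "f \<in> hardy_space adj r q p"
  shows "ereal (hardy_norm adj r q p f) = hardy_enorm adj r q p f"
  using assms hardy_enorm_nonneg[of adj r q p f]
  by (auto simp: hardy_norm_def hardy_space_def ereal_real)

lemma tree_mean_le_hardy_norm:
  assumes "f \<in> hardy_space adj r q p"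
  shows "tree_mean adj r q p n f \<le> hardy_norm adj r q p f"
proof -
  have "ereal (tree_mean adj r q p n f) \<le> ereal (hardy_norm adj r q p f)"
    unfolding ereal_hardy_norm[OF assms] hardy_enorm_def by (rule SUP_upper) simp
  then show ?thesis
    by simp
qed

lemma hardy_norm_le:
  assumes "\<And>n. tree_mean adj r q p n f \<le> B"
  shows "f \<in> hardy_space adj r q p" "hardy_norm adj r q p f \<le> B"
proof -
  have le: "hardy_enorm adj r q p f \<le> ereal B"
    unfolding hardy_enorm_def using assms by (auto intro: SUP_least)
  then show mem: "f \<in> hardy_space adj r q p"
    unfolding hardy_space_def using le_less_trans by fastforce
  show "hardy_norm adj r q p f \<le> B"
    using le unfolding ereal_hardy_norm[OF mem, symmetric] by simp
qed

lemma cc_space_subset_hardy_space: "cc_space adj r q p \<subseteq> hardy_space adj r q p"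
proof
  fix f assume f: "f \<in> cc_space adj r q p"
  let ?M = "\<lambda>n. tree_mean adj r q p n f"
  \<comment> \<open>All but finitely many levels contribute just the value 0, so the means take
    finitely many values and have a maximum.\<close>
  have "range ?M \<subseteq> insert 0 (?M ` {n. ?M n \<noteq> 0})"
    by auto
  then have "finite (range ?M)"
    using f unfolding cc_space_def by (auto intro: finite_subset)
  then have "?M n \<le> Max (range ?M)" for n
    by simp
  then show "f \<in> hardy_space adj r q p"
    by (rule hardy_norm_le)
qed

text \<open>The comparison of means at each level passes to the supremum, to the limit by squeezing,
  and to the set of levels with nonzero mean; these three transfers give solidity of the respective
  spaces.\<close>

lemma solid_tree_function_space:
  fixes r :: 'v
  assumes "1 \<le> q" "infinite (UNIV :: 'v set)" "homogeneous_tree d adj" "0 < p"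
    and X: "X \<in> {hardy_space adj r q p, little_hardy_space adj r q p, cc_space adj r q p}"
  shows "solid_function_space X (hardy_norm adj r q p)"
proof
  note sphere = finite_tree_sphere[OF assms(3), of r] tree_sphere_nonempty[OF assms(3,2), of r]
  note mean_nonneg = tree_mean_nonneg[OF sphere]
  have sub: "X \<subseteq> hardy_space adj r q p"
    using X by (auto simp: little_hardy_space_def dest: subsetD[OF cc_space_subset_hardy_space])
  \<comment> \<open>True for every \<open>f\<close>, since \<open>real_of_ereal\<close> sends an
    infinite supremum to 0.\<close>
  show "0 \<le> hardy_norm adj r q p f" for f
    unfolding hardy_norm_def by (simp add: real_of_ereal_pos hardy_enorm_nonneg)
  show "f \<in> X \<and> hardy_norm adj r q p f \<le> C * hardy_norm adj r q p g"
    if g: "g \<in> X" and C: "0 \<le> C" and le: "\<And>v. cmod (f v) \<le> C * cmod (g v)" for f g C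
  proof -
    have mean: "tree_mean adj r q p n f \<le> C * tree_mean adj r q p n g" for n
      using tree_mean_mono[OF sphere assms(4) C le] .
    then have "tree_mean adj r q p n f \<le> C * hardy_norm adj r q p g" for n
      using tree_mean_le_hardy_norm[of g] sub g C by (meson mult_left_mono order_trans subsetD)
    then have f: "f \<in> hardy_space adj r q p" "hardy_norm adj r q p f \<le> C * hardy_norm adj r q p g"
      by (rule hardy_norm_le)+
    have "f \<in> little_hardy_space adj r q p" if little: "g \<in> little_hardy_space adj r q p"
    proof -
      have "(\<lambda>n. C * tree_mean adj r q p n g) \<longlonglongrightarrow> C * 0"
        using little by (intro tendsto_intros) (simp add: little_hardy_space_def)
      then have "(\<lambda>n. tree_mean adj r q p n f) \<longlonglongrightarrow> 0"
        using tendsto_sandwich[of "\<lambda>_. 0" "\<lambda>n. tree_mean adj r q p n f" sequentially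
            "\<lambda>n. C * tree_mean adj r q p n g" 0] mean mean_nonneg by simp
      with f(1) show ?thesis
        by (simp add: little_hardy_space_def)
    qed
    moreover have "f \<in> cc_space adj r q p" if "g \<in> cc_space adj r q p"
    proof -
      have "tree_mean adj r q p n f = 0" if "tree_mean adj r q p n g = 0" for n
        using mean[of n] mean_nonneg[of q p n f] that by simp
      then have "{n. tree_mean adj r q p n f \<noteq> 0} \<subseteq> {n. tree_mean adj r q p n g \<noteq> 0}"
        by blast
      with that show ?thesis
        unfolding cc_space_def using finite_subset by blast
    qed
    ultimately show ?thesis
      using f X g by blast
  qed
  show mem: "vertex_indicator v \<in> X" for v
  proof -
    have zero: "tree_mean adj r q p n (vertex_indicator v) = 0" if "n \<noteq> tree_level adj r v" for n
      using tree_mean_indicator_eq_0[OF assms(3) sphere(2) assms(4) that] .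
    then have "{n. tree_mean adj r q p n (vertex_indicator v) \<noteq> 0} \<subseteq> {tree_level adj r v}"
      by blast
    then have cc: "vertex_indicator v \<in> cc_space adj r q p"
      unfolding cc_space_def using finite_subset by blast
    moreover have "(\<lambda>n. tree_mean adj r q p n (vertex_indicator v)) \<longlonglongrightarrow> 0"
      by (intro tendsto_eventually eventually_mono[OF eventually_gt_at_top[of "tree_level adj r v"]] zero)
        simp
    moreover have "vertex_indicator v \<in> hardy_space adj r q p"
      using cc by (rule subsetD[OF cc_space_subset_hardy_space])
    ultimately show ?thesis
      using X by (auto simp: little_hardy_space_def)
  qed
  show "0 < hardy_norm adj r q p (vertex_indicator v)" for v
    using tree_mean_indicator_pos[OF assms(3,1)] tree_mean_le_hardy_norm[OF subsetD[OF sub mem]]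
    by (rule less_le_trans)
qed

theorem theorem7:
  fixes adj :: "'v \<Rightarrow> 'v \<Rightarrow> bool"
    and r :: 'v
    and q :: nat
    and p :: ereal
    and X :: "('v \<Rightarrow> complex) set"
    and \<psi> :: "'v \<Rightarrow> complex"
  assumes "q \<ge> 1"
    and "infinite (UNIV :: 'v set)"
    and "homogeneous_tree (q + 1) adj"
    and "1 \<le> p"
    and "X \<in> {hardy_space adj r q p, little_hardy_space adj r q p, cc_space adj r q p}"
    and "bounded_operator_on X (hardy_norm adj r q p) (mult_op \<psi>)"
  shows "point_spectrum X (mult_op \<psi>) = range \<psi> \<and>
    spectrum_on X (hardy_norm adj r q p) (mult_op \<psi>) =
      approx_point_spectrum X (hardy_norm adj r q p) (mult_op \<psi>) \<and>
    approx_point_spectrum X (hardy_norm adj r q p) (mult_op \<psi>) = closure (range \<psi>)"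
proof -
  have "0 < p"
    using \<open>1 \<le> p\<close> less_le_trans[of 0 1 p] by simp
  then interpret solid_function_space X "hardy_norm adj r q p"
    by (rule solid_tree_function_space[OF assms(1-3) _ assms(5)])
  \<comment> \<open>Closure of the range, approximate point spectrum, spectrum, and back to the
    closure: the three inclusions form a cycle, so all three sets coincide.\<close>
  note subs = closure_range_subset_approx_point_spectrum[of \<psi>]
    approx_point_spectrum_subset_spectrum[OF assms(6)] spectrum_subset_closure_range[of \<psi>]
  show ?thesis
    by (intro conjI equalityI point_spectrum_mult_op subs subset_trans[OF subs(3) subs(1)]
        subset_trans[OF subs(2) subs(3)])
qed

end
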